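(* Let $A=\operatorname{tritoep}(a,b,c)\in\mathbb{C}^{n\times n}$ with $bc\neq 0$ be nonsingular and let $\mathbf{b}\in\mathbb{C}^n$ be such that $K=[\mathbf{b},A\mathbf{b},\dots,A^{n-1}\mathbf{b}]$ is nonsingular. Let $AK=WR$ be the QR factorization with $W=[\mathbf{w}_1,\dots,\mathbf{w}_n]$ unitary and $R$ nonsingular upper triangular, so that $A=WRCR^{-1}W^*$ with $C$ the companion matrix of the characteristic polynomial of $A$, and write $\mathbf{b}=\sum_{i=1}^n\eta_i\mathbf{w}_i$. Then there exists an affine family of tridiagonal Toeplitz matrices $$\mathcal{F}_{b/c}=\{\,t\cdot\operatorname{tritoep}(a,b,c)+\alpha I \;:\; \alpha\in\mathbb{C},\ 0\neq t\in\mathbb{C}\,\},$$ characterized by the ratio $b/c$ and parameterized by $(\alpha,t)$, whose (nonsingular) members can generate the residual Arnoldi space associated to the columns of $W$: for each nonsingular $\widetilde{A}=tA+\alpha I\in\mathcal{F}_{b/c}$ there is a vector $\widetilde{\mathbf{b}}\in\mathbb{C}^n$ with $\operatorname{span}\{\mathbf{w}_1,\dots,\mathbf{w}_j\}=\widetilde{A}\,\mathcal{K}_j(\widetilde{A},\widetilde{\mathbf{b}})$ for all $j\le n$. Moreover, the choices of $\alpha$ and $t$ completely determine (once the free scale $r_{11}\ne0$, the $(1,1)$ entry, is fixed) a unique upper triangular matrix $R_{t,\alpha}$ associated to that $W$, i.e. such that $\widetilde{A}=WR_{t,\alpha}\widetilde{C}R_{t,\alpha}^{-1}W^*$, where $\widetilde{C}$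 is the companion matrix of the characteristic polynomial of $\widetilde{A}$.
   Context: $\operatorname{tritoep}(a,b,c)$ denotes the $n\times n$ tridiagonal Toeplitz matrix with diagonal entries $a$, subdiagonal entries $b$ and superdiagonal entries $c$. $\mathcal{K}_j(M,\mathbf{v})=\operatorname{span}\{\mathbf{v},M\mathbf{v},\dots,M^{j-1}\mathbf{v}\}$. For a matrix $M$ with characteristic polynomial $\det(zI-M)=z^n-\sum_{i=0}^{n-1}c_iz^i$, its companion matrix has ones on the first subdiagonal, last column $(c_0,\dots,c_{n-1})^T$, and zeros elsewhere. The factorization $A=WRCR^{-1}W^*$ is called the APS (Arioli–Pták–Strakoš) parameterization of $A$. Since GMRES is invariant under scaling of the right-hand side, the entry $r_{11}$ of the upper triangular factor is always a free scale. *)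

theory Defs
  imports "Jordan_Normal_Form.Schur_Decomposition" "Jordan_Normal_Form.VS_Connect"
    "Jordan_Normal_Form.Gauss_Jordan_Elimination" Complex_Main
begin

text \<open>Indices of vectors and matrices are 0-based.\<close>

definition tritoep :: "nat \<Rightarrow> complex \<Rightarrow> complex \<Rightarrow> complex \<Rightarrow> complex mat" where
  "tritoep n a b c = mat n n (\<lambda>(i, j).
     if i = j then a else if i = j + 1 then b else if j = i + 1 then c else 0)"

definition tritoep_family :: "nat \<Rightarrow> complex \<Rightarrow> complex \<Rightarrow> complex \<Rightarrow> complex mat set" where
  "tritoep_family n a b c =
     {t \<cdot>\<^sub>m tritoep n a b c + \<alpha> \<cdot>\<^sub>m 1\<^sub>m n | \<alpha> t. t \<noteq> 0}"

abbreviation cspan :: "nat \<Rightarrow> complex vec set \<Rightarrow> complex vec set" where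
  "cspan n S \<equiv> LinearCombinations.module.span class_ring (module_vec TYPE(complex) n) S"

definition krylov_space :: "nat \<Rightarrow> complex mat \<Rightarrow> complex vec \<Rightarrow> complex vec set" where
  "krylov_space j M v = cspan (dim_vec v) {(M ^\<^sub>m i) *\<^sub>v v | i. i < j}"

definition krylov_mat :: "complex mat \<Rightarrow> complex vec \<Rightarrow> complex mat" where
  "krylov_mat M v = mat_of_cols (dim_vec v) (map (\<lambda>i. (M ^\<^sub>m i) *\<^sub>v v) [0..<dim_vec v])"

definition unitary_mat :: "complex mat \<Rightarrow> bool" where
  "unitary_mat U \<longleftrightarrow>
     square_mat U \<and> inverts_mat U (mat_adjoint U) \<and> inverts_mat (mat_adjoint U) U"

text \<open>The characteristic polynomial is written \<open>z\<^sup>n - (c\<^sub>0 + \<dots> + c\<^bsub>n-1\<^esub> z\<^bsup>n-1\<^esup>)\<close>, so the last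
  column consists of the negated coefficients of \<^const>\<open>char_poly\<close>.\<close>

definition companion_of :: "complex mat \<Rightarrow> complex mat" where
  "companion_of M = (let n = dim_row M in mat n n (\<lambda>(i, j).
     if j = n - 1 then - coeff (char_poly M) i else if i = j + 1 then 1 else 0))"

text \<open>\<^const>\<open>mat_inverse\<close> is option-valued; the value below is meaningful only for
  invertible matrices.\<close>

abbreviation mat_inv :: "complex mat \<Rightarrow> complex mat" where
  "mat_inv M \<equiv> the (mat_inverse M)"

end

theory Submission
  imports Defs
begin

text \<open>A factorization \<open>M = W R C R\<^sup>-\<^sup>1 W\<^sup>*\<close> with \<open>C\<close> the companion matrix of \<open>M\<close> says exactly that
  \<open>W R\<close> is a Krylov matrix of \<open>M\<close>: comparing columns in \<open>M (W R) = (W R) C\<close> gives one direction,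
  Cayley--Hamilton the other. In particular \<open>R\<close> is determined by \<open>M\<close>, \<open>W\<close> and \<open>r\<^sub>1\<^sub>1\<close>. For existence,
  \<open>H = W\<^sup>* A W = R C R\<^sup>-\<^sup>1\<close> is upper Hessenberg with nonzero subdiagonal, and this property passes to
  \<open>t H + \<alpha> I\<close>; the Krylov matrix of such a matrix started at a multiple of the first unit vector is
  upper triangular with nonzero diagonal. Taking \<open>b = M\<^sup>-\<^sup>1 w\<^sub>1\<close> as the starting vector of \<open>M\<close>, the same
  triangular factor identifies the residual Krylov spaces with the spans of the first columns of
  \<open>W\<close>.\<close>

section \<open>The Cayley-Hamilton theorem, entry by entry\<close>

text \<open>The entrywise form keeps all sums scalar, as needed later for the components of
  \<open>M^n v\<close>.\<close>

lemma cayley_hamilton_index: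
  fixes M :: "'a :: comm_ring_1 mat"
  assumes M: "M \<in> carrier_mat n n" and i: "i < n" and j: "j < n"
  shows "(\<Sum>k\<le>n. coeff (char_poly M) k * (M ^\<^sub>m k) $$ (i, j)) = 0"
proof -
  let ?p = "char_poly M"
  define B where "B = adj_mat (char_poly_matrix M)"
  have B: "B \<in> carrier_mat n n"
    and adj: "char_poly_matrix M * B = ?p \<cdot>\<^sub>m 1\<^sub>m n"
    using adj_mat[of "char_poly_matrix M" n] M by (auto simp: B_def char_poly_def)
  define N where "N k = mat n n (\<lambda>ij. coeff (B $$ ij) k)" for k
  have N: "N k \<in> carrier_mat n n" for k by (simp add: N_def)
  \<comment> \<open>Comparing coefficients of \<open>(X I - M) adj (X I - M) = p I\<close> gives \<open>M N\<^sub>k = N\<^sub>k\<^sub>-\<^sub>1 - p\<^sub>k I\<close>, so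
    that \<open>\<Sum> p\<^sub>k M\<^sup>k\<close> telescopes.\<close>
  have entry: "[:0, 1:] * B $$ (r, l) - (\<Sum>m<n. [:M $$ (r, m):] * B $$ (m, l))
      = (if r = l then ?p else 0)" if "r < n" "l < n" for r l
  proof -
    have "(if r = l then ?p else 0) = (char_poly_matrix M * B) $$ (r, l)"
      using that by (simp add: adj)
    also have "\<dots> = (\<Sum>m<n. ((if r = m then [:0, 1:] else 0) + [:- M $$ (r, m):]) * B $$ (m, l))"
      using that B M by (auto simp: scalar_prod_def char_poly_matrix_def lessThan_atLeast0 intro!: sum.cong)
    also have "\<dots> = (\<Sum>m<n. (if r = m then [:0, 1:] * B $$ (m, l) else 0))
        - (\<Sum>m<n. [:M $$ (r, m):] * B $$ (m, l))"
      unfolding sum_subtractf[symmetric] by (intro sum.cong) (auto simp: algebra_simps)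
    finally show ?thesis using that by simp
  qed
  have rec0: "M * N 0 = - coeff ?p 0 \<cdot>\<^sub>m 1\<^sub>m n"
  proof (rule eq_matI)
    fix r l assume "r < dim_row (- coeff ?p 0 \<cdot>\<^sub>m 1\<^sub>m n)" "l < dim_col (- coeff ?p 0 \<cdot>\<^sub>m 1\<^sub>m n)"
    then have rl: "r < n" "l < n" by auto
    from arg_cong[OF entry[OF rl], of "\<lambda>q. coeff q 0"] rl M
    show "(M * N 0) $$ (r, l) = (- coeff ?p 0 \<cdot>\<^sub>m 1\<^sub>m n) $$ (r, l)"
      by (auto simp: N_def scalar_prod_def lessThan_atLeast0 coeff_sum split: if_splits)
        (metis minus_minus)
  qed (use M N in auto)
  have rec: "M * N (Suc k) = N k + (- coeff ?p (Suc k)) \<cdot>\<^sub>m 1\<^sub>m n" for k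
  proof (rule eq_matI)
    fix r l assume "r < dim_row (N k + (- coeff ?p (Suc k)) \<cdot>\<^sub>m 1\<^sub>m n)"
      "l < dim_col (N k + (- coeff ?p (Suc k)) \<cdot>\<^sub>m 1\<^sub>m n)"
    then have rl: "r < n" "l < n" by auto
    from arg_cong[OF entry[OF rl], of "\<lambda>q. coeff q (Suc k)"] rl M
    show "(M * N (Suc k)) $$ (r, l) = (N k + (- coeff ?p (Suc k)) \<cdot>\<^sub>m 1\<^sub>m n) $$ (r, l)"
      by (auto simp: N_def scalar_prod_def lessThan_atLeast0 coeff_sum algebra_simps split: if_splits)
  qed (use M N in auto)
  have pow: "M ^\<^sub>m k \<in> carrier_mat n n" for k using M by simp
  have partial: "(\<Sum>k\<le>K. coeff ?p k * (M ^\<^sub>m k) $$ (i, j)) = - (M ^\<^sub>m (Suc K) * N K) $$ (i, j)" for K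
  proof (induction K)
    case 0
    then show ?case using M N rec0 i j by simp
  next
    case (Suc K)
    have "M ^\<^sub>m (Suc (Suc K)) * N (Suc K) = M ^\<^sub>m (Suc K) * (M * N (Suc K))"
      using pow M N by (simp add: assoc_mult_mat[of _ n n _ n _ n])
    also have "\<dots> = M ^\<^sub>m (Suc K) * N K + (- coeff ?p (Suc K)) \<cdot>\<^sub>m M ^\<^sub>m (Suc K)"
      unfolding rec using pow[of "Suc K"] N right_mult_one_mat[OF pow[of "Suc K"]]
      by (simp add: mult_add_distrib_mat[of _ n n _ n] mult_smult_distrib[of _ n n _ n] del: pow_mat.simps)
    finally have "(M ^\<^sub>m (Suc (Suc K)) * N (Suc K)) $$ (i, j)
      = (M ^\<^sub>m (Suc K) * N K) $$ (i, j) - coeff ?p (Suc K) * (M ^\<^sub>m (Suc K)) $$ (i, j)"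
      using i j carrier_matD[OF pow[of "Suc K"]] carrier_matD[OF N[of K]] by (simp del: pow_mat.simps)
    then show ?case using Suc.IH by (simp del: pow_mat.simps)
  qed
  \<comment> \<open>\<open>K\<close> is at least \<open>n\<close> and exceeds the degree of every
    entry of \<open>B\<close>. Hence the term with \<open>N K\<close> left over by telescoping
    vanishes, while the summands beyond \<open>n\<close> are zero because \<open>char_poly M\<close>
    has degree \<open>n\<close>.\<close>
  define K where "K = n + (\<Sum>r<n. \<Sum>l<n. Suc (degree (B $$ (r, l))))"
  have "coeff (B $$ (r, l)) K = 0" if "r < n" "l < n" for r l
  proof (rule coeff_eq_0)
    have "Suc (degree (B $$ (r, l))) \<le> (\<Sum>l<n. Suc (degree (B $$ (r, l))))"
      using that by (intro member_le_sum[of l "{..<n}" "\<lambda>l. Suc (degree (B $$ (r, l)))"]) auto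
    also have "\<dots> \<le> (\<Sum>r<n. \<Sum>l<n. Suc (degree (B $$ (r, l))))"
      using that by (intro member_le_sum[of r "{..<n}" "\<lambda>r. \<Sum>l<n. Suc (degree (B $$ (r, l)))"]) auto
    finally show "degree (B $$ (r, l)) < K" by (simp add: K_def)
  qed
  then have "N K = 0\<^sub>m n n" by (auto simp: N_def)
  then have "(\<Sum>k\<le>K. coeff ?p k * (M ^\<^sub>m k) $$ (i, j)) = 0"
    using partial[of K] right_mult_zero_mat[OF pow[of "Suc K"]] i j by (simp del: pow_mat.simps)
  also have "(\<Sum>k\<le>K. coeff ?p k * (M ^\<^sub>m k) $$ (i, j)) = (\<Sum>k\<le>n. coeff ?p k * (M ^\<^sub>m k) $$ (i, j))"
    using degree_monic_char_poly[OF M]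
    by (intro sum.mono_neutral_right) (auto simp: K_def coeff_eq_0)
  finally show ?thesis .
qed

section \<open>Inverses and invertible triangular matrices\<close>

text \<open>\<open>mat_inverse\<close> yields \<open>None\<close> only for non-units of the matrix
  ring, so invertibility makes \<open>the\<close> harmless.\<close>

lemma mat_inv_inverse:
  assumes "M \<in> carrier_mat n n" "invertible_mat M"
  shows "mat_inv M \<in> carrier_mat n n" and "M * mat_inv M = 1\<^sub>m n" and "mat_inv M * M = 1\<^sub>m n"
proof -
  obtain B where B: "M * B = 1\<^sub>m n" "B * M = 1\<^sub>m (dim_row B)"
    using assms by (auto simp: invertible_mat_def inverts_mat_def)
  have "B \<in> carrier_mat n n"
    using arg_cong[OF B(1), of dim_col] arg_cong[OF B(2), of dim_col] assms(1) by auto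
  with B have "M \<in> Units (ring_mat TYPE(complex) n ())"
    using assms(1) by (auto simp: Units_def ring_mat_def)
  then obtain C where "mat_inverse M = Some C"
    using mat_inverse(1)[OF assms(1), where b = "()"] by (cases "mat_inverse M") auto
  with mat_inverse(2)[OF assms(1)] show "mat_inv M \<in> carrier_mat n n"
    "M * mat_inv M = 1\<^sub>m n" "mat_inv M * M = 1\<^sub>m n" by auto
qed

lemma invertible_upper_triangular_iff:
  fixes R :: "complex mat"
  assumes R: "R \<in> carrier_mat n n" and ut: "upper_triangular R"
  shows "invertible_mat R \<longleftrightarrow> (\<forall>i<n. R $$ (i, i) \<noteq> 0)"
proof -
  have "invertible_mat R \<longleftrightarrow> det R \<noteq> 0"
  proof
    assume "invertible_mat R"
    from mat_inv_inverse[OF R this] have "det R * det (mat_inv R) = 1"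
      using det_mult[OF R, of "mat_inv R"] by simp
    then show "det R \<noteq> 0" by auto
  next
    assume "det R \<noteq> 0"
    from det_non_zero_imp_unit[OF R this] show "invertible_mat R"
      using R by (auto simp: Units_def ring_mat_def invertible_mat_def inverts_mat_def)
  qed
  then show ?thesis
    using upper_triangular_imp_det_eq_0_iff[OF R ut] R by (auto simp: diag_mat_def)
qed

section \<open>Krylov matrices and the companion relation\<close>

lemma pow_mat_mult_vec_carrier [simp]:
  "M \<in> carrier_mat n n \<Longrightarrow> v \<in> carrier_vec n \<Longrightarrow> (M ^\<^sub>m k) *\<^sub>v v \<in> carrier_vec n"
  by (intro mult_mat_vec_carrier[of _ n n]) auto

lemma col_krylov_mat [simp]:
  "v \<in> carrier_vec n \<Longrightarrow> j < n \<Longrightarrow> M \<in> carrier_mat n n \<Longrightarrow> col (krylov_mat M v) j = (M ^\<^sub>m j) *\<^sub>v v"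
  unfolding krylov_mat_def by (subst col_mat_of_cols) auto

lemma krylov_mat_carrier [simp]: "v \<in> carrier_vec n \<Longrightarrow> krylov_mat M v \<in> carrier_mat n n"
  unfolding krylov_mat_def by auto

lemma index_krylov_mat:
  assumes "v \<in> carrier_vec n" "M \<in> carrier_mat n n" "i < n" "j < n"
  shows "krylov_mat M v $$ (i, j) = ((M ^\<^sub>m j) *\<^sub>v v) $ i"
  using assms by (simp add: krylov_mat_def mat_of_cols_index)

lemma companion_of_carrier [simp]: "M \<in> carrier_mat n n \<Longrightarrow> companion_of M \<in> carrier_mat n n"
  unfolding companion_of_def Let_def by auto

lemma col_companion_of:
  assumes "M \<in> carrier_mat n n" "Suc j < n"
  shows "col (companion_of M) j = unit_vec n (Suc j)"
  using assms by (intro eq_vecI) (auto simp: companion_of_def Let_def)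

text \<open>\<open>pow_mat\<close> adds its new factor on the right, so the second equation is a
  mere reassociation, while the first needs an induction with \<open>v\<close> generalized.\<close>

lemma pow_mat_Suc_vec:
  assumes "M \<in> carrier_mat n n" "v \<in> carrier_vec n"
  shows "(M ^\<^sub>m Suc k) *\<^sub>v v = M *\<^sub>v ((M ^\<^sub>m k) *\<^sub>v v)"
    and "(M ^\<^sub>m Suc k) *\<^sub>v v = (M ^\<^sub>m k) *\<^sub>v (M *\<^sub>v v)"
proof -
  have c: "M ^\<^sub>m k \<in> carrier_mat n n" for k using assms by simp
  show 2: "(M ^\<^sub>m Suc k) *\<^sub>v v = (M ^\<^sub>m k) *\<^sub>v (M *\<^sub>v v)" for k
    using assms c[of k] by (simp add: assoc_mult_mat_vec[of _ n n])
  show "(M ^\<^sub>m Suc k) *\<^sub>v v = M *\<^sub>v ((M ^\<^sub>m k) *\<^sub>v v)"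
    using assms(2)
  proof (induction k arbitrary: v)
    case (Suc k)
    have "(M ^\<^sub>m Suc (Suc k)) *\<^sub>v v = (M ^\<^sub>m Suc k) *\<^sub>v (M *\<^sub>v v)"
      using assms(1) Suc.prems c[of "Suc k"] by (simp add: assoc_mult_mat_vec[of _ n n])
    also have "\<dots> = M *\<^sub>v ((M ^\<^sub>m k) *\<^sub>v (M *\<^sub>v v))"
      using Suc assms(1) by auto
    also have "(M ^\<^sub>m k) *\<^sub>v (M *\<^sub>v v) = (M ^\<^sub>m Suc k) *\<^sub>v v"
      using assms(1) Suc.prems c[of k] by (simp add: assoc_mult_mat_vec[of _ n n])
    finally show ?case .
  qed (use assms(1) in auto)
qed

lemma mult_mat_unit_vec:
  fixes P :: "'a :: semiring_1 mat"
  assumes "P \<in> carrier_mat m n" "j < n"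
  shows "P *\<^sub>v unit_vec n j = col P j"
  using assms by (intro eq_vecI) auto

text \<open>Multiplication by \<open>M\<close> shifts the columns \<open>M^j v\<close> by one, as do
  the subdiagonal ones of the companion matrix; the last column is Cayley-Hamilton applied to
  \<open>v\<close>.\<close>

lemma krylov_mat_companion:
  assumes M: "M \<in> carrier_mat n n" and v: "v \<in> carrier_vec n"
  shows "M * krylov_mat M v = krylov_mat M v * companion_of M"
proof (rule mat_col_eqI)
  have K: "krylov_mat M v \<in> carrier_mat n n" using v by simp
  have C: "companion_of M \<in> carrier_mat n n" using M by simp
  fix j assume "j < dim_col (krylov_mat M v * companion_of M)"
  then have j: "j < n" using C by simp
  have lhs: "col (M * krylov_mat M v) j = (M ^\<^sub>m Suc j) *\<^sub>v v"
    unfolding col_mult2[OF M K j] pow_mat_Suc_vec(1)[OF M v] using v j M by simp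
  show "col (M * krylov_mat M v) j = col (krylov_mat M v * companion_of M) j"
  proof (cases "Suc j < n")
    case True
    then have "krylov_mat M v *\<^sub>v col (companion_of M) j = (M ^\<^sub>m Suc j) *\<^sub>v v"
      using v M K by (simp add: col_companion_of[OF M True] mult_mat_unit_vec[OF K] del: pow_mat.simps)
    then show ?thesis unfolding lhs col_mult2[OF K C j] by simp
  next
    case False
    with j have n: "n = Suc j" by simp
    have pow: "M ^\<^sub>m k \<in> carrier_mat n n" for k using M by simp
    \<comment> \<open>Cayley-Hamilton is summed against \<open>v\<close>. As
      \<open>char_poly M\<close> is monic, \<open>M^n v\<close> can be isolated, and the resulting
      minus signs are those in the last column of \<open>companion_of M\<close>.\<close>
    have "((M ^\<^sub>m n) *\<^sub>v v) $ i = (krylov_mat M v *\<^sub>v col (companion_of M) j) $ i" if i: "i < n" for i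
    proof -
      have idx: "((M ^\<^sub>m k) *\<^sub>v v) $ i = (\<Sum>l<n. (M ^\<^sub>m k) $$ (i, l) * v $ l)" for k
        using carrier_matD[OF pow[of k]] i v by (simp add: scalar_prod_def lessThan_atLeast0)
      have "(\<Sum>k\<le>n. coeff (char_poly M) k * ((M ^\<^sub>m k) *\<^sub>v v) $ i)
          = (\<Sum>l<n. (\<Sum>k\<le>n. coeff (char_poly M) k * (M ^\<^sub>m k) $$ (i, l)) * v $ l)"
        unfolding idx sum_distrib_left sum_distrib_right by (subst sum.swap) (simp add: ac_simps)
      also have "\<dots> = 0" using cayley_hamilton_index[OF M i] by simp
      finally have "((M ^\<^sub>m n) *\<^sub>v v) $ i = - (\<Sum>k<n. coeff (char_poly M) k * ((M ^\<^sub>m k) *\<^sub>v v) $ i)"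
        using degree_monic_char_poly[OF M] by (simp add: lessThan_Suc_atMost[symmetric] add_eq_0_iff2 flip: lessThan_Suc_atMost)
      also have "\<dots> = (\<Sum>k<n. krylov_mat M v $$ (i, k) * companion_of M $$ (k, j))"
        unfolding sum_negf[symmetric] using M n
        by (intro sum.cong) (simp_all add: index_krylov_mat[OF v M i] companion_of_def Let_def)
      also have "\<dots> = (krylov_mat M v *\<^sub>v col (companion_of M) j) $ i"
        using i j K C by (simp add: scalar_prod_def lessThan_atLeast0)
      finally show ?thesis .
    qed
    then show ?thesis unfolding lhs col_mult2[OF K C j] using K pow[of n] n
      by (intro eq_vecI) auto
  qed
qed (use M carrier_matD[OF krylov_mat_carrier[OF v]] carrier_matD[OF companion_of_carrier[OF M]] in auto)

text \<open>All companion columns but the last are unit vectors, so the equation forces each column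
  of \<open>P\<close> to be \<open>M\<close> times its predecessor. The first column then determines
  \<open>P\<close>, which is the source of uniqueness.\<close>

lemma eq_krylov_mat_if_companion:
  assumes M: "M \<in> carrier_mat n n" and P: "P \<in> carrier_mat n n"
    and eq: "M * P = P * companion_of M"
  shows "P = krylov_mat M (col P 0)"
proof (rule mat_col_eqI)
  have c0: "col P 0 \<in> carrier_vec n" using P by (metis carrier_matD(1) col_dim)
  have C: "companion_of M \<in> carrier_mat n n" using M by simp
  have cols: "j < n \<Longrightarrow> col P j = (M ^\<^sub>m j) *\<^sub>v col P 0" for j
  proof (induction j)
    case 0
    then show ?case using M c0 by simp
  next
    case (Suc j)
    then have j: "j < n" by simp
    have "col P (Suc j) = col (P * companion_of M) j"
      using Suc.prems by (simp add: col_mult2[OF P C j] col_companion_of[OF M] mult_mat_unit_vec[OF P])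
    also have "\<dots> = M *\<^sub>v col P j" unfolding eq[symmetric] by (rule col_mult2[OF M P j])
    also have "\<dots> = (M ^\<^sub>m Suc j) *\<^sub>v col P 0"
      unfolding pow_mat_Suc_vec(1)[OF M c0] using Suc.IH j by simp
    finally show ?case .
  qed
  show "col P j = col (krylov_mat M (col P 0)) j" if "j < dim_col (krylov_mat M (col P 0))" for j
  proof -
    have j: "j < n" using that carrier_matD[OF krylov_mat_carrier[OF c0]] by simp
    show ?thesis unfolding col_krylov_mat[OF c0 j M] by (rule cols[OF j])
  qed
  show "dim_row P = dim_row (krylov_mat M (col P 0))" "dim_col P = dim_col (krylov_mat M (col P 0))"
    using c0 P by (auto simp: krylov_mat_def)
qed


text \<open>The intertwining passes to all powers: \<open>M^j (W y) = W (H^j y)\<close>. It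
  transports Krylov matrices between \<open>M\<close> and its representation
  \<open>H\<close>.\<close>

lemma krylov_mat_intertwine:
  assumes M: "M \<in> carrier_mat n n" and H: "H \<in> carrier_mat n n" and W: "W \<in> carrier_mat n n"
    and y: "y \<in> carrier_vec n" and eq: "M * W = W * H"
  shows "krylov_mat M (W *\<^sub>v y) = W * krylov_mat H y"
proof (rule mat_col_eqI)
  have Wy: "W *\<^sub>v y \<in> carrier_vec n" using W y by simp
  have K: "krylov_mat H y \<in> carrier_mat n n" using y by simp
  have pow: "(M ^\<^sub>m j) *\<^sub>v (W *\<^sub>v y) = W *\<^sub>v ((H ^\<^sub>m j) *\<^sub>v y)" for j
  proof (induction j)
    case (Suc j)
    have Hy: "(H ^\<^sub>m j) *\<^sub>v y \<in> carrier_vec n" using H y by simp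
    have "(M ^\<^sub>m Suc j) *\<^sub>v (W *\<^sub>v y) = M * W *\<^sub>v ((H ^\<^sub>m j) *\<^sub>v y)"
      unfolding pow_mat_Suc_vec(1)[OF M Wy] Suc.IH by (simp add: assoc_mult_mat_vec[OF M W Hy])
    also have "\<dots> = W *\<^sub>v ((H ^\<^sub>m Suc j) *\<^sub>v y)"
      unfolding eq pow_mat_Suc_vec(1)[OF H y] by (rule assoc_mult_mat_vec[OF W H Hy])
    finally show ?case .
  qed (use M H W y in simp)
  fix j assume "j < dim_col (W * krylov_mat H y)"
  then have j: "j < n" using K by simp
  show "col (krylov_mat M (W *\<^sub>v y)) j = col (W * krylov_mat H y) j"
    unfolding col_mult2[OF W K j] col_krylov_mat[OF Wy j M] col_krylov_mat[OF y j H] by (rule pow)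
qed (use assms in \<open>auto simp: krylov_mat_def\<close>)

section \<open>Unreduced Hessenberg matrices\<close>

definition unreduced_hessenberg :: "nat \<Rightarrow> 'a :: zero mat \<Rightarrow> bool" where
  "unreduced_hessenberg n H \<longleftrightarrow>
     (\<forall>i<n. \<forall>j. Suc j < i \<longrightarrow> H $$ (i, j) = 0) \<and> (\<forall>j. Suc j < n \<longrightarrow> H $$ (Suc j, j) \<noteq> 0)"

text \<open>The shift touches only the diagonal, and \<open>t \<noteq> 0\<close> keeps the
  subdiagonal nonzero. This invariance is why one \<open>W\<close> serves the whole family.\<close>

lemma unreduced_hessenberg_affine:
  fixes H :: "'a :: field mat"
  assumes "unreduced_hessenberg n H" "H \<in> carrier_mat n n" "t \<noteq> 0"
  shows "unreduced_hessenberg n (t \<cdot>\<^sub>m H + \<alpha> \<cdot>\<^sub>m 1\<^sub>m n)"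
  using assms by (auto simp: unreduced_hessenberg_def)

text \<open>For \<open>j + 1 < n\<close>, column \<open>j\<close> of the equation writes column
  \<open>j + 1\<close> of \<open>R\<close> as a combination of columns \<open>0, ..., j\<close> of
  \<open>H\<close>, so the zero pattern of \<open>R\<close> is handed on to \<open>H\<close> column
  by column.\<close>

lemma unreduced_hessenberg_if_companion:
  assumes H: "H \<in> carrier_mat n n" and R: "R \<in> carrier_mat n n" and M: "M \<in> carrier_mat n n"
    and ut: "upper_triangular R" and diag: "\<And>i. i < n \<Longrightarrow> R $$ (i, i) \<noteq> 0"
    and eq: "H * R = R * companion_of M"
  shows "unreduced_hessenberg n H"
proof -
  have C: "companion_of M \<in> carrier_mat n n" using M by simp
  have sum: "(\<Sum>k\<le>j. H $$ (i, k) * R $$ (k, j)) = R $$ (i, Suc j)" if i: "i < n" and j: "Suc j < n" for i j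
  proof -
    have "(\<Sum>k\<le>j. H $$ (i, k) * R $$ (k, j)) = (\<Sum>k<n. H $$ (i, k) * R $$ (k, j))"
      using j R upper_triangularD[OF ut] by (intro sum.mono_neutral_left) auto
    also have "\<dots> = (H * R) $$ (i, j)"
      using i j H R by (simp add: scalar_prod_def lessThan_atLeast0)
    also have "\<dots> = col (R * companion_of M) j $ i"
      unfolding eq using i j R C by simp
    also have "\<dots> = R $$ (i, Suc j)"
      using i j R by (simp add: col_mult2[OF R C] col_companion_of[OF M] mult_mat_unit_vec[OF R])
    finally show ?thesis .
  qed
  \<comment> \<open>By induction all terms before the last vanish, so
    \<open>H $$ (i, j) * R $$ (j, j)\<close> equals an entry of \<open>R\<close> below its
    diagonal.\<close>
  have below: "i < n \<Longrightarrow> Suc j < i \<Longrightarrow> H $$ (i, j) = 0" for i j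
  proof (induction j rule: less_induct)
    case (less j)
    then have "(\<Sum>k\<le>j. H $$ (i, k) * R $$ (k, j)) = H $$ (i, j) * R $$ (j, j)"
      by (simp add: lessThan_Suc_atMost[symmetric])
    moreover have "R $$ (i, Suc j) = 0" using ut R less.prems by auto
    ultimately show ?case using sum[of i j] diag[of j] less.prems by simp
  qed
  \<comment> \<open>In row \<open>j + 1\<close> the same sum gives the subdiagonal entry as a
    quotient of two consecutive diagonal entries of \<open>R\<close>.\<close>
  have "H $$ (Suc j, j) \<noteq> 0" if "Suc j < n" for j
  proof -
    have "(\<Sum>k\<le>j. H $$ (Suc j, k) * R $$ (k, j)) = H $$ (Suc j, j) * R $$ (j, j)"
      using that below[of "Suc j"] by (simp add: lessThan_Suc_atMost[symmetric])
    then show ?thesis using sum[of "Suc j" j] diag[of "Suc j"] that by auto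
  qed
  with below show ?thesis by (auto simp: unreduced_hessenberg_def)
qed

text \<open>Each factor \<open>H\<close> extends the support of the vector by one index and
  multiplies its last nonzero entry by a subdiagonal entry. The diagonal of \<open>K\<close> thus
  consists of \<open>r\<close> times products of nonzero subdiagonal entries of
  \<open>H\<close>.\<close>

lemma krylov_mat_unreduced_hessenberg:
  assumes H: "H \<in> carrier_mat n n" and hess: "unreduced_hessenberg n H"
    and r: "r \<noteq> 0" and n: "0 < n"
  defines "K \<equiv> krylov_mat H (r \<cdot>\<^sub>v unit_vec n 0)"
  shows "upper_triangular K" and "\<And>i. i < n \<Longrightarrow> K $$ (i, i) \<noteq> 0"
proof -
  let ?e = "r \<cdot>\<^sub>v unit_vec n 0"
  have e: "?e \<in> carrier_vec n" by simp
  have K: "K \<in> carrier_mat n n" by (simp add: K_def)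
  have index: "K $$ (i, j) = ((H ^\<^sub>m j) *\<^sub>v ?e) $ i" if "i < n" "j < n" for i j
    unfolding K_def by (rule index_krylov_mat[OF e H that])
  have main: "j < n \<Longrightarrow> (\<forall>i<n. j < i \<longrightarrow> ((H ^\<^sub>m j) *\<^sub>v ?e) $ i = 0) \<and> ((H ^\<^sub>m j) *\<^sub>v ?e) $ j \<noteq> 0" for j
  proof (induction j)
    case 0
    then show ?case using H r by simp
  next
    case (Suc j)
    let ?x = "(H ^\<^sub>m j) *\<^sub>v ?e"
    have x: "?x \<in> carrier_vec n" using H by simp
    have step: "((H ^\<^sub>m Suc j) *\<^sub>v ?e) $ i = (\<Sum>k\<le>j. H $$ (i, k) * ?x $ k)" if "i < n" for i
    proof -
      have "((H ^\<^sub>m Suc j) *\<^sub>v ?e) $ i = (\<Sum>k<n. H $$ (i, k) * ?x $ k)"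
        unfolding pow_mat_Suc_vec(1)[OF H e] using H x that
        by (simp add: scalar_prod_def lessThan_atLeast0)
      also have "\<dots> = (\<Sum>k\<le>j. H $$ (i, k) * ?x $ k)"
        using Suc by (intro sum.mono_neutral_right) auto
      finally show ?thesis .
    qed
    have "((H ^\<^sub>m Suc j) *\<^sub>v ?e) $ i = 0" if "i < n" "Suc j < i" for i
      unfolding step[OF that(1)] using that hess
      by (intro sum.neutral) (auto simp: unreduced_hessenberg_def)
    moreover have "((H ^\<^sub>m Suc j) *\<^sub>v ?e) $ Suc j = H $$ (Suc j, j) * ?x $ j"
      unfolding step[OF Suc.prems] using Suc.prems hess
      by (simp add: lessThan_Suc_atMost[symmetric] unreduced_hessenberg_def)
    ultimately show ?case
      using Suc hess by (simp add: unreduced_hessenberg_def)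
  qed
  show "upper_triangular K"
    using K main by (intro upper_triangularI) (auto simp: index)
  show "K $$ (i, i) \<noteq> 0" if "i < n" for i
    using main that by (simp add: index)
qed

section \<open>Unitary matrices and the APS factorization\<close>

lemma unitary_matD:
  assumes "unitary_mat W" "W \<in> carrier_mat n n"
  shows "mat_adjoint W \<in> carrier_mat n n" "W * mat_adjoint W = 1\<^sub>m n" "mat_adjoint W * W = 1\<^sub>m n"
proof -
  show c: "mat_adjoint W \<in> carrier_mat n n"
    using assms(2) unfolding mat_adjoint_def mat_of_rows_def by auto
  show "W * mat_adjoint W = 1\<^sub>m n" "mat_adjoint W * W = 1\<^sub>m n"
    using assms c by (auto simp: unitary_mat_def inverts_mat_def)
qed

text \<open>\<open>mat_inv R * mat_adjoint W\<close> is the inverse of \<open>W * R\<close>, so the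
  factorization is a similarity. Its inverse-free form is the one to which the Krylov lemmas
  apply.\<close>

lemma APS_factorization_iff:
  assumes M: "M \<in> carrier_mat n n" and W: "W \<in> carrier_mat n n" "unitary_mat W"
    and R: "R \<in> carrier_mat n n" "invertible_mat R"
  shows "M = W * R * companion_of M * mat_inv R * mat_adjoint W \<longleftrightarrow>
    M * (W * R) = W * R * companion_of M"
proof -
  note W' = unitary_matD[OF W(2,1)] and R' = mat_inv_inverse[OF R]
  have C: "companion_of M \<in> carrier_mat n n" using M by simp
  define P where "P = W * R"
  define Q where "Q = mat_inv R * mat_adjoint W"
  have P: "P \<in> carrier_mat n n" and Q: "Q \<in> carrier_mat n n"
    using W(1) R(1) W'(1) R'(1) by (auto simp: P_def Q_def)
  have "P * Q = P * mat_inv R * mat_adjoint W"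
    unfolding Q_def by (rule assoc_mult_mat[OF P R'(1) W'(1), symmetric])
  also have "P * mat_inv R = W * (R * mat_inv R)"
    unfolding P_def by (rule assoc_mult_mat[OF W(1) R(1) R'(1)])
  finally have PQ: "P * Q = 1\<^sub>m n" using W(1) W'(2) R'(2) by simp
  have QP: "Q * P = 1\<^sub>m n" by (rule mat_mult_left_right_inverse[OF P Q PQ])
  have "W * R * companion_of M * mat_inv R * mat_adjoint W = P * companion_of M * Q"
    unfolding Q_def P_def[symmetric] using mult_carrier_mat[OF P C] by (rule assoc_mult_mat[OF _ R'(1) W'(1)])
  moreover have "M = P * companion_of M * Q \<longleftrightarrow> M * P = P * companion_of M"
  proof
    assume "M = P * companion_of M * Q"
    then have "M * P = P * companion_of M * Q * P" by (rule arg_cong[of _ _ "\<lambda>X. X * P"])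
    also have "\<dots> = P * companion_of M * (Q * P)" using P C Q by (intro assoc_mult_mat) auto
    finally show "M * P = P * companion_of M" using P C QP by simp
  next
    assume "M * P = P * companion_of M"
    then have "P * companion_of M * Q = M * (P * Q)" using M P Q by (metis assoc_mult_mat)
    then show "M = P * companion_of M * Q" using M PQ by simp
  qed
  ultimately show ?thesis by (simp add: P_def)
qed

section \<open>Spans of leading columns\<close>

text \<open>As ranges of matrices, spans can be compared by factoring the matrices.\<close>

lemma cspan_eq_range:
  assumes "\<And>i. i < j \<Longrightarrow> f i \<in> carrier_vec n"
  shows "cspan n {f i | i. i < j} = (\<lambda>x. mat_of_cols n (map f [0..<j]) *\<^sub>v x) ` carrier_vec j"
proof -
  interpret vec_space "TYPE(complex)" n .
  let ?P = "mat_of_cols n (map f [0..<j])"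
  have P: "?P \<in> carrier_mat n j" by auto
  have "set (cols ?P) = {f i | i. i < j}"
    using assms by (subst cols_mat_of_cols) auto
  then have "cspan n {f i | i. i < j} = col_space ?P" by (simp add: col_space_def)
  also have "\<dots> = (\<lambda>x. ?P *\<^sub>v x) ` carrier_vec j"
    unfolding col_space_eq[OF P] using P by auto
  finally show ?thesis .
qed

text \<open>The first \<open>j\<close> columns of \<open>W * R\<close> are those of \<open>W\<close>
  times the leading \<open>j\<close> by \<open>j\<close> block of \<open>R\<close>. This block is
  invertible because its diagonal is nonzero, so the range is unchanged.\<close>

lemma cspan_cols_mult_upper_triangular:
  assumes W: "W \<in> carrier_mat n n" and R: "R \<in> carrier_mat n n" "upper_triangular R"
    and inv: "invertible_mat R" and j: "j \<le> n"
  shows "cspan n {col W i | i. i < j} = cspan n {col (W * R) i | i. i < j}"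
proof -
  have diag: "R $$ (i, i) \<noteq> 0" if "i < n" for i
    using invertible_upper_triangular_iff[OF R] inv that by auto
  define S where "S = mat j j (\<lambda>ij. R $$ ij)"
  have S: "S \<in> carrier_mat j j" by (simp add: S_def)
  have "upper_triangular S"
    using R(1) j upper_triangularD[OF R(2)] by (intro upper_triangularI) (simp add: S_def)
  from invertible_upper_triangular_iff[OF S this] have "invertible_mat S"
    using diag j by (simp add: S_def)
  note S' = mat_inv_inverse[OF S this]
  let ?V = "mat_of_cols n (map (col W) [0..<j])"
  have V: "?V \<in> carrier_mat n j" by auto
  have VS: "mat_of_cols n (map (col (W * R)) [0..<j]) = ?V * S" (is "?U = _")
  proof (rule eq_matI)
    fix i l assume "i < dim_row (?V * S)" "l < dim_col (?V * S)"
    then have il: "i < n" "l < j" using S by auto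
    have "?U $$ (i, l) = (\<Sum>k<n. W $$ (i, k) * R $$ (k, l))"
      using il W R j by (simp add: mat_of_cols_index scalar_prod_def lessThan_atLeast0)
    \<comment> \<open>For \<open>l < j\<close>, column \<open>l\<close> of \<open>R\<close> vanishes
      from row \<open>j\<close> on, so only the leading block contributes.\<close>
    also have "\<dots> = (\<Sum>k<j. W $$ (i, k) * R $$ (k, l))"
      using il R(1) j upper_triangularD[OF R(2)] by (intro sum.mono_neutral_right) auto
    also have "\<dots> = (?V * S) $$ (i, l)"
      using il W S V j by (simp add: S_def scalar_prod_def lessThan_atLeast0 mat_of_cols_index)
    finally show "?U $$ (i, l) = (?V * S) $$ (i, l)" .
  qed (use S in auto)
  have surj: "(\<lambda>x. S *\<^sub>v x) ` carrier_vec j = carrier_vec j"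
  proof
    show "carrier_vec j \<subseteq> (\<lambda>x. S *\<^sub>v x) ` carrier_vec j"
    proof
      fix x :: "complex vec" assume x: "x \<in> carrier_vec j"
      then have "x = S *\<^sub>v (mat_inv S *\<^sub>v x)"
        using S S' by (simp add: assoc_mult_mat_vec[symmetric, of _ j j _ j])
      moreover have "mat_inv S *\<^sub>v x \<in> carrier_vec j" using S'(1) x by simp
      ultimately show "x \<in> (\<lambda>x. S *\<^sub>v x) ` carrier_vec j" by blast
    qed
  qed (use S in auto)
  have "(\<lambda>x. ?V *\<^sub>v x) ` carrier_vec j = (\<lambda>x. ?V *\<^sub>v x) ` (\<lambda>x. S *\<^sub>v x) ` carrier_vec j"
    unfolding surj ..
  also have "\<dots> = (\<lambda>x. ?U *\<^sub>v x) ` carrier_vec j"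
    unfolding VS image_image using assoc_mult_mat_vec[OF V S] by (intro image_cong) auto
  finally show ?thesis using W R j
    by (subst (1 2) cspan_eq_range) (auto intro!: carrier_vecI)
qed

text \<open>\<open>M\<close> commutes with its powers, so applying it to a Krylov space moves the
  starting vector from \<open>v\<close> to \<open>M *\<^sub>v v\<close>.\<close>

lemma image_krylov_space:
  assumes M: "M \<in> carrier_mat n n" and v: "v \<in> carrier_vec n" and j: "j \<le> n"
  shows "(\<lambda>x. M *\<^sub>v x) ` krylov_space j M v = cspan n {col (krylov_mat M (M *\<^sub>v v)) i | i. i < j}"
proof -
  let ?V = "mat_of_cols n (map (\<lambda>i. (M ^\<^sub>m i) *\<^sub>v v) [0..<j])"
  let ?K = "krylov_mat M (M *\<^sub>v v)"
  have Mv: "M *\<^sub>v v \<in> carrier_vec n" using M v by simp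
  have V: "?V \<in> carrier_mat n j" by auto
  have MV: "M * ?V = mat_of_cols n (map (col ?K) [0..<j])"
  proof (rule mat_col_eqI)
    fix i assume "i < dim_col (mat_of_cols n (map (col ?K) [0..<j]))"
    then have i: "i < j" by simp
    have Mi: "(M ^\<^sub>m i) *\<^sub>v v \<in> carrier_vec n" using M v by simp
    have Ki: "(M ^\<^sub>m i) *\<^sub>v (M *\<^sub>v v) \<in> carrier_vec n" using M Mv by simp
    have "col (M * ?V) i = M *\<^sub>v ((M ^\<^sub>m i) *\<^sub>v v)"
      unfolding col_mult2[OF M V i] using i Mi by (subst col_mat_of_cols) auto
    also have "\<dots> = col ?K i"
      using i j by (simp add: pow_mat_Suc_vec[OF M v, symmetric] col_krylov_mat[OF Mv _ M]
          pow_mat_Suc_vec(2)[OF M v, symmetric] del: pow_mat.simps)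
    also have "\<dots> = col (mat_of_cols n (map (col ?K) [0..<j])) i"
      using i j Ki by (subst col_mat_of_cols) (auto simp: col_krylov_mat[OF Mv _ M])
    finally show "col (M * ?V) i = col (mat_of_cols n (map (col ?K) [0..<j])) i" .
  qed (use M in auto)
  have "krylov_space j M v = (\<lambda>x. ?V *\<^sub>v x) ` carrier_vec j"
    unfolding krylov_space_def using v M by (simp add: cspan_eq_range)
  then have "(\<lambda>x. M *\<^sub>v x) ` krylov_space j M v = (\<lambda>x. M * ?V *\<^sub>v x) ` carrier_vec j"
    using assoc_mult_mat_vec[OF M V] by (simp add: image_image cong: image_cong)
  also have "\<dots> = cspan n {col ?K i | i. i < j}"
    unfolding MV using j Mv M by (subst cspan_eq_range) auto
  finally show ?thesis .
qed

section \<open>The affine family of tridiagonal Toeplitz matrices\<close>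

lemma tritoep_affine:
  "t \<cdot>\<^sub>m tritoep n a b c + \<alpha> \<cdot>\<^sub>m 1\<^sub>m n = tritoep n (t * a + \<alpha>) (t * b) (t * c)"
  by (auto simp: tritoep_def)

lemma tritoep_family_eq:
  assumes bc: "b * c \<noteq> 0"
  shows "tritoep_family n a b c = {tritoep n a' b' c' | a' b' c'. b' * c' \<noteq> 0 \<and> b' / c' = b / c}"
proof (intro equalityI subsetI)
  fix M assume "M \<in> tritoep_family n a b c"
  then obtain \<alpha> t where "t \<noteq> 0" "M = tritoep n (t * a + \<alpha>) (t * b) (t * c)"
    by (auto simp: tritoep_family_def tritoep_affine)
  moreover have "t * b * (t * c) \<noteq> 0" "t * b / (t * c) = b / c" using bc \<open>t \<noteq> 0\<close> by auto
  ultimately show "M \<in> {tritoep n a' b' c' | a' b' c'. b' * c' \<noteq> 0 \<and> b' / c' = b / c}" by blast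
next
  fix M assume "M \<in> {tritoep n a' b' c' | a' b' c'. b' * c' \<noteq> 0 \<and> b' / c' = b / c}"
  then obtain a' b' c' where M: "M = tritoep n a' b' c'" and bc': "b' * c' \<noteq> 0" "b' / c' = b / c"
    by blast
  \<comment> \<open>\<open>t\<close> matches the subdiagonal. Equality of the ratios makes it fit
    the superdiagonal too, and the shift \<open>a' - t * a\<close> corrects the diagonal.\<close>
  define t where "t = b' / b"
  have t: "t \<noteq> 0" "t * b = b'" "t * c = c'" using bc bc' by (auto simp: t_def field_simps)
  have "M = t \<cdot>\<^sub>m tritoep n a b c + (a' - t * a) \<cdot>\<^sub>m 1\<^sub>m n"
    using t by (simp add: M tritoep_affine)
  with t(1) show "M \<in> tritoep_family n a b c" unfolding tritoep_family_def by blast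
qed

section \<open>Triangular factors for the members of the family\<close>

text \<open>The factor is built in the coordinates given by \<open>W\<close>. The product
  \<open>W * R'\<close> then serves twice: its leading columns give the residual spaces, and its
  companion relation gives the factorization.\<close>

lemma affine_krylov_triangular_factor:
  assumes n: "0 < n" and A: "A \<in> carrier_mat n n" and W: "W \<in> carrier_mat n n" "unitary_mat W"
    and R: "R \<in> carrier_mat n n" "upper_triangular R" "invertible_mat R"
    and eq: "A * (W * R) = W * R * companion_of A"
    and t: "t \<noteq> 0" and r: "r \<noteq> 0"
  obtains R' where "R' \<in> carrier_mat n n" "upper_triangular R'" "invertible_mat R'" "R' $$ (0, 0) = r"
    "W * R' = krylov_mat (t \<cdot>\<^sub>m A + \<alpha> \<cdot>\<^sub>m 1\<^sub>m n) (r \<cdot>\<^sub>v col W 0)"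
proof -
  note W' = unitary_matD[OF W(2,1)]
  have C: "companion_of A \<in> carrier_mat n n" using A by simp
  \<comment> \<open>\<open>H\<close> represents \<open>A\<close> in the basis of columns of
    \<open>W\<close>. In it the relation for \<open>W * R\<close> becomes
    \<open>H * R = R * companion_of A\<close>.\<close>
  define H where "H = mat_adjoint W * (A * W)"
  have H: "H \<in> carrier_mat n n" using A W(1) W'(1) by (auto simp: H_def)
  have "W * H = W * mat_adjoint W * (A * W)"
    unfolding H_def using W(1) W'(1) A by (intro assoc_mult_mat[symmetric]) auto
  then have WH: "A * W = W * H" using W'(2) W(1) A by simp
  have "H * R = mat_adjoint W * (A * W * R)"
    unfolding H_def using W(1) W'(1) A R(1) by (intro assoc_mult_mat) auto
  also have "A * W * R = A * (W * R)" by (rule assoc_mult_mat[OF A W(1) R(1)])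
  also have "\<dots> = W * (R * companion_of A)" unfolding eq by (rule assoc_mult_mat[OF W(1) R(1) C])
  also have "mat_adjoint W * \<dots> = mat_adjoint W * W * (R * companion_of A)"
    using W(1) W'(1) R(1) C by (intro assoc_mult_mat[symmetric]) auto
  also have "\<dots> = R * companion_of A" using W'(3) R(1) C by simp
  finally have "unreduced_hessenberg n H"
    using unreduced_hessenberg_if_companion[OF H R(1) A R(2)]
      invertible_upper_triangular_iff[OF R(1,2)] R(3) by blast
  define H' where "H' = t \<cdot>\<^sub>m H + \<alpha> \<cdot>\<^sub>m 1\<^sub>m n"
  define M where "M = t \<cdot>\<^sub>m A + \<alpha> \<cdot>\<^sub>m 1\<^sub>m n"
  have H': "H' \<in> carrier_mat n n" and M: "M \<in> carrier_mat n n" using H A by (auto simp: H'_def M_def)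
  have hess: "unreduced_hessenberg n H'"
    unfolding H'_def by (rule unreduced_hessenberg_affine) fact+
  have "M * W = t \<cdot>\<^sub>m (A * W) + \<alpha> \<cdot>\<^sub>m W"
    unfolding M_def using A W(1) by (simp add: add_mult_distrib_mat[of _ n n _ _ n] mult_smult_assoc_mat[of _ n n _ n])
  also have "\<dots> = W * H'"
    unfolding WH H'_def using H W(1) by (simp add: mult_add_distrib_mat[of _ n n _ n] mult_smult_distrib[of _ n n _ n])
  finally have MW: "M * W = W * H'" .
  let ?e = "r \<cdot>\<^sub>v unit_vec n 0"
  \<comment> \<open>Starting at \<open>r\<close> times the first unit vector puts \<open>r\<close>
    in the corner, and \<open>W\<close> carries this vector to
    \<open>r \<cdot>\<^sub>v col W 0\<close>.\<close>
  define R' where "R' = krylov_mat H' ?e"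
  note K = krylov_mat_unreduced_hessenberg[OF H' hess r n, folded R'_def]
  have R': "R' \<in> carrier_mat n n" by (simp add: R'_def)
  have e: "W *\<^sub>v ?e = r \<cdot>\<^sub>v col W 0"
    using W(1) n mult_mat_vec[OF W(1), of "unit_vec n 0" r] by (simp add: mult_mat_unit_vec[OF W(1)])
  show thesis
  proof (rule that[OF R' K(1)])
    show "invertible_mat R'" using invertible_upper_triangular_iff[OF R' K(1)] K(2) by blast
    have "R' $$ (0, 0) = col R' 0 $ 0" using R' n by simp
    also have "col R' 0 = ?e" unfolding R'_def using H' n by (subst col_krylov_mat[OF _ n H']) auto
    finally show "R' $$ (0, 0) = r" using n by simp
    have "krylov_mat M (W *\<^sub>v ?e) = W * R'"
      unfolding R'_def by (rule krylov_mat_intertwine[OF M H' W(1) _ MW]) simp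
    then show "W * R' = krylov_mat (t \<cdot>\<^sub>m A + \<alpha> \<cdot>\<^sub>m 1\<^sub>m n) (r \<cdot>\<^sub>v col W 0)"
      by (simp add: e M_def)
  qed
qed

theorem theorem3p14:
  fixes n :: nat and a b c :: complex and A W R :: "complex mat"
    and bv :: "complex vec" and \<eta> :: "nat \<Rightarrow> complex"
  assumes "n > 0"
    and "A = tritoep n a b c"
    and "b * c \<noteq> 0"
    and "invertible_mat A"
    and "bv \<in> carrier_vec n"
    and "invertible_mat (krylov_mat A bv)"
    and "W \<in> carrier_mat n n" and "unitary_mat W"
    and "R \<in> carrier_mat n n" and "upper_triangular R" and "invertible_mat R"
    and "A * krylov_mat A bv = W * R"
    and "bv = finsum_vec TYPE(complex) n (\<lambda>i. \<eta> i \<cdot>\<^sub>v col W i) {..<n}"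
  shows "A = W * R * companion_of A * mat_inv R * mat_adjoint W
    \<and> tritoep_family n a b c =
        {tritoep n a' b' c' | a' b' c'. b' * c' \<noteq> 0 \<and> b' / c' = b / c}
    \<and> (\<forall>M \<in> tritoep_family n a b c. invertible_mat M \<longrightarrow>
        (\<exists>bt \<in> carrier_vec n. \<forall>j \<le> n.
           cspan n {col W i | i. i < j} = (\<lambda>x. M *\<^sub>v x) ` krylov_space j M bt))
    \<and> (\<forall>\<alpha> t r11. t \<noteq> 0 \<longrightarrow> r11 \<noteq> 0 \<longrightarrow> invertible_mat (t \<cdot>\<^sub>m A + \<alpha> \<cdot>\<^sub>m 1\<^sub>m n) \<longrightarrow>
        (\<exists>!R'. R' \<in> carrier_mat n n \<and> upper_triangular R' \<and> invertible_mat R' \<and> R' $$ (0, 0) = r11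
           \<and> t \<cdot>\<^sub>m A + \<alpha> \<cdot>\<^sub>m 1\<^sub>m n =
               W * R' * companion_of (t \<cdot>\<^sub>m A + \<alpha> \<cdot>\<^sub>m 1\<^sub>m n) * mat_inv R' * mat_adjoint W))"
proof (intro conjI)
  have A: "A \<in> carrier_mat n n" using assms(2) by (simp add: tritoep_def)
  note bv = assms(5) and W = assms(7,8) and R = assms(9-11)
  have C: "companion_of A \<in> carrier_mat n n" using A by simp
  have K: "krylov_mat A bv \<in> carrier_mat n n" using bv by simp
  \<comment> \<open>Left multiplication by \<open>A\<close> carries the companion relation from
    \<open>krylov_mat A bv\<close> over to \<open>W * R\<close>.\<close>
  have "A * (A * krylov_mat A bv) = A * (krylov_mat A bv * companion_of A)"
    by (simp add: krylov_mat_companion[OF A bv])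
  also have "\<dots> = A * krylov_mat A bv * companion_of A"
    by (rule assoc_mult_mat[OF A K C, symmetric])
  finally have eq: "A * (W * R) = W * R * companion_of A" by (simp only: assms(12))
  show "A = W * R * companion_of A * mat_inv R * mat_adjoint W"
    using APS_factorization_iff[OF A W R(1,3)] eq by blast
  show "tritoep_family n a b c =
      {tritoep n a' b' c' | a' b' c'. b' * c' \<noteq> 0 \<and> b' / c' = b / c}"
    by (rule tritoep_family_eq[OF assms(3)])
  have w0: "col W 0 \<in> carrier_vec n" using W(1) by (metis carrier_matD(1) col_dim)
  show "\<forall>M \<in> tritoep_family n a b c. invertible_mat M \<longrightarrow>
      (\<exists>bt \<in> carrier_vec n. \<forall>j \<le> n.
         cspan n {col W i | i. i < j} = (\<lambda>x. M *\<^sub>v x) ` krylov_space j M bt)"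
  proof (intro ballI impI)
    fix M assume "M \<in> tritoep_family n a b c" and inv: "invertible_mat M"
    then obtain t \<alpha> where t: "t \<noteq> 0" and M_eq: "M = t \<cdot>\<^sub>m A + \<alpha> \<cdot>\<^sub>m 1\<^sub>m n"
      by (auto simp: tritoep_family_def assms(2))
    have M: "M \<in> carrier_mat n n" using A by (simp add: M_eq)
    obtain R' where R': "R' \<in> carrier_mat n n" "upper_triangular R'" "invertible_mat R'"
      and WR': "W * R' = krylov_mat M (1 \<cdot>\<^sub>v col W 0)"
      using affine_krylov_triangular_factor[OF assms(1) A W R eq t one_neq_zero, of \<alpha>] M_eq by blast
    note M' = mat_inv_inverse[OF M inv]
    \<comment> \<open>\<open>bt\<close> is chosen so that \<open>M *\<^sub>v bt\<close> is
      \<open>col W 0\<close>, the starting vector of \<open>W * R'\<close>; the invertibility of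
      \<open>M\<close> enters here.\<close>
    define bt where "bt = mat_inv M *\<^sub>v col W 0"
    have bt: "bt \<in> carrier_vec n" using M'(1) w0 by (simp add: bt_def)
    have "M *\<^sub>v bt = col W 0"
      unfolding bt_def using M'(2) w0 by (simp add: assoc_mult_mat_vec[OF M M'(1) w0, symmetric])
    then have "cspan n {col W i | i. i < j} = (\<lambda>x. M *\<^sub>v x) ` krylov_space j M bt" if "j \<le> n" for j
      using cspan_cols_mult_upper_triangular[OF W(1) R' that] image_krylov_space[OF M bt that] WR'
      by simp
    then show "\<exists>bt \<in> carrier_vec n. \<forall>j \<le> n.
        cspan n {col W i | i. i < j} = (\<lambda>x. M *\<^sub>v x) ` krylov_space j M bt"
      using bt by blast
  qed
  show "\<forall>\<alpha> t r11. t \<noteq> 0 \<longrightarrow> r11 \<noteq> 0 \<longrightarrow> invertible_mat (t \<cdot>\<^sub>m A + \<alpha> \<cdot>\<^sub>m 1\<^sub>m n) \<longrightarrow>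
        (\<exists>!R'. R' \<in> carrier_mat n n \<and> upper_triangular R' \<and> invertible_mat R' \<and> R' $$ (0, 0) = r11
           \<and> t \<cdot>\<^sub>m A + \<alpha> \<cdot>\<^sub>m 1\<^sub>m n =
               W * R' * companion_of (t \<cdot>\<^sub>m A + \<alpha> \<cdot>\<^sub>m 1\<^sub>m n) * mat_inv R' * mat_adjoint W)"
  proof (intro allI impI)
    fix \<alpha> t r :: complex assume t: "t \<noteq> 0" and r: "r \<noteq> 0"
    define M where "M = t \<cdot>\<^sub>m A + \<alpha> \<cdot>\<^sub>m 1\<^sub>m n"
    have M: "M \<in> carrier_mat n n" using A by (simp add: M_def)
    have rw: "r \<cdot>\<^sub>v col W 0 \<in> carrier_vec n" using w0 by simp
    obtain R' where R': "R' \<in> carrier_mat n n" "upper_triangular R'" "invertible_mat R'" "R' $$ (0, 0) = r"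
      and WR': "W * R' = krylov_mat M (r \<cdot>\<^sub>v col W 0)"
      using affine_krylov_triangular_factor[OF assms(1) A W R eq t r, of \<alpha>] M_def by blast
    have fact: "M = W * R' * companion_of M * mat_inv R' * mat_adjoint W"
      using APS_factorization_iff[OF M W R'(1,3)] krylov_mat_companion[OF M rw] unfolding WR' by blast
    \<comment> \<open>A competitor \<open>S\<close> makes \<open>W * S\<close> a Krylov matrix as
      well. Triangularity and the corner entry fix its first column as
      \<open>r \<cdot>\<^sub>v col W 0\<close>, so it equals \<open>W * R'\<close>, and the unitary
      \<open>W\<close> cancels.\<close>
    have unique: "S = R'" if S: "S \<in> carrier_mat n n" "upper_triangular S" "invertible_mat S" "S $$ (0, 0) = r"
      and S_fact: "M = W * S * companion_of M * mat_inv S * mat_adjoint W" for S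
    proof -
      have WS: "W * S \<in> carrier_mat n n" using W(1) S(1) by simp
      have "col S 0 = r \<cdot>\<^sub>v unit_vec n 0"
        using S(1,4) assms(1) upper_triangularD[OF S(2)] by (intro eq_vecI) auto
      then have col: "col (W * S) 0 = r \<cdot>\<^sub>v col W 0"
        using mult_mat_vec[OF W(1), of "unit_vec n 0" r]
        by (simp add: col_mult2[OF W(1) S(1) assms(1)] mult_mat_unit_vec[OF W(1) assms(1)])
      have "M * (W * S) = W * S * companion_of M"
        using APS_factorization_iff[OF M W S(1,3)] S_fact by blast
      from eq_krylov_mat_if_companion[OF M WS this] have WS_eq: "W * S = W * R'"
        unfolding col WR' .
      note W' = unitary_matD[OF W(2,1)]
      have "X = mat_adjoint W * (W * X)" if "X \<in> carrier_mat n n" for X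
        using that W'(3) by (simp add: assoc_mult_mat[OF W'(1) W(1) that, symmetric])
      then show "S = R'" using WS_eq S(1) R'(1) by metis
    qed
    show "\<exists>!R'. R' \<in> carrier_mat n n \<and> upper_triangular R' \<and> invertible_mat R' \<and> R' $$ (0, 0) = r
           \<and> t \<cdot>\<^sub>m A + \<alpha> \<cdot>\<^sub>m 1\<^sub>m n =
               W * R' * companion_of (t \<cdot>\<^sub>m A + \<alpha> \<cdot>\<^sub>m 1\<^sub>m n) * mat_inv R' * mat_adjoint W"
      unfolding M_def[symmetric]
    proof (rule ex1I[of _ R'])
      show "R' \<in> carrier_mat n n \<and> upper_triangular R' \<and> invertible_mat R' \<and> R' $$ (0, 0) = r
        \<and> M = W * R' * companion_of M * mat_inv R' * mat_adjoint W"
        using R' fact by blast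
    qed (use unique in blast)
  qed
qed

end
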